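(* Let $(\mathbf{A},\tau)$ be an $n$-subtractive $T_0$-topological algebra, let $1\le i\le n-1$, and let $a,b\in \mathrm{Diag}_i(\mathbf{A})$. (i) If $s_i(a,b)\neq 0$, then $a$ and $b$ are $T_2$-separated in the subspace $\mathrm{Diag}_i(\mathbf{A})$. (ii) If $s_i(a,b)$ and $0$ are $T_2$-separated in $A$, then $a$ and $b$ are $T_{2\frac12}$-separated in the subspace $\mathrm{Diag}_i(\mathbf{A})$.
   Context: An algebra $\mathbf{A}$ is $n$-subtractive ($n\ge2$) with respect to a constant $0$ and binary terms $s_1,\dots,s_{n-1}$ if it satisfies $s_1(x,x)=0$, $s_j(x,0)=s_{j+1}(x,x)$ for $j=1,\dots,n-2$, and $s_{n-1}(x,0)=x$. $\mathrm{Diag}_i(\mathbf{A})=\{a\in A: s_i(a,a)=0\}$, with the subspace topology. A topological algebra is an algebra with a topology making every basic operation continuous (domain with product topology); it is $T_0$ if the topology is $T_0$. Points $c,d$ are $T_2$-separated if they have disjoint open neighbourhoods, and $T_{2\frac12}$-separated if they have open neighbourhoods $U\ni c$, $V\ni d$ whose closures are disjoint. *)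

theory Defs
  imports "HOL-Analysis.Analysis"
begin

text \<open>A finitary algebra is given by a signature \<open>ar :: 'f \<Rightarrow> nat\<close> (a type of operation symbols with
  their arities), a carrier \<open>A\<close> and an interpretation \<open>I\<close>. Only the values of \<open>I f\<close> on lists over \<open>A\<close>
  of length \<open>ar f\<close> are relevant.\<close>

definition universal_algebra ::
    "('f \<Rightarrow> nat) \<Rightarrow> ('f \<Rightarrow> 'a list \<Rightarrow> 'a) \<Rightarrow> 'a set \<Rightarrow> bool" where
  "universal_algebra ar I A \<longleftrightarrow>
     (\<forall>f xs. length xs = ar f \<and> set xs \<subseteq> A \<longrightarrow> I f xs \<in> A)"

datatype 'f trm = TVar nat | TOp 'f "'f trm list"

primrec trm_vars :: "'f trm \<Rightarrow> nat set" where
  "trm_vars (TVar v) = {v}"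
| "trm_vars (TOp f ts) = \<Union> (set (map trm_vars ts))"

primrec wf_trm :: "('f \<Rightarrow> nat) \<Rightarrow> 'f trm \<Rightarrow> bool" where
  "wf_trm ar (TVar v) \<longleftrightarrow> True"
| "wf_trm ar (TOp f ts) \<longleftrightarrow> length ts = ar f \<and> list_all id (map (wf_trm ar) ts)"

definition trm_arity :: "('f \<Rightarrow> nat) \<Rightarrow> nat \<Rightarrow> 'f trm \<Rightarrow> bool" where
  "trm_arity ar k t \<longleftrightarrow> wf_trm ar t \<and> trm_vars t \<subseteq> {..<k}"

text \<open>The term operation of a \<open>k\<close>-ary term: the variable \<open>TVar v\<close> denotes the \<open>v\<close>-th entry of the
  argument list, counted from 0.\<close>

primrec trm_op :: "('f \<Rightarrow> 'a list \<Rightarrow> 'a) \<Rightarrow> 'f trm \<Rightarrow> 'a list \<Rightarrow> 'a" where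
  "trm_op I (TVar v) xs = xs ! v"
| "trm_op I (TOp f ts) xs = I f (map (\<lambda>t. trm_op I t xs) ts)"

text \<open>The constant is a term \<open>z\<close> without variables; a constant symbol \<open>c\<close> is the case \<open>TOp c []\<close>.\<close>

definition n_subtractive ::
    "('f \<Rightarrow> nat) \<Rightarrow> ('f \<Rightarrow> 'a list \<Rightarrow> 'a) \<Rightarrow> 'a set \<Rightarrow> nat \<Rightarrow> 'f trm \<Rightarrow> (nat \<Rightarrow> 'f trm) \<Rightarrow> bool" where
  "n_subtractive ar I A n z s \<longleftrightarrow>
     n \<ge> 2 \<and> trm_arity ar 0 z \<and> (\<forall>j\<in>{1..n - 1}. trm_arity ar 2 (s j)) \<and>
     (\<forall>x\<in>A. trm_op I (s 1) [x, x] = trm_op I z []) \<and>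
     (\<forall>j\<in>{1..n - 2}. \<forall>x\<in>A. trm_op I (s j) [x, trm_op I z []] = trm_op I (s (j + 1)) [x, x]) \<and>
     (\<forall>x\<in>A. trm_op I (s (n - 1)) [x, trm_op I z []] = x)"

definition Diag ::
    "('f \<Rightarrow> 'a list \<Rightarrow> 'a) \<Rightarrow> 'a set \<Rightarrow> 'f trm \<Rightarrow> (nat \<Rightarrow> 'f trm) \<Rightarrow> nat \<Rightarrow> 'a set" where
  "Diag I A z s i = {a \<in> A. trm_op I (s i) [a, a] = trm_op I z []}"

text \<open>The domain of \<open>I f\<close> carries the product topology on the power with index set \<open>{..<ar f}\<close>, whose
  points are functions on that index set; \<open>map x [0..<ar f]\<close> is the tuple \<open>x\<close> written as a list.\<close>

definition topological_algebra ::
    "('f \<Rightarrow> nat) \<Rightarrow> ('f \<Rightarrow> 'a list \<Rightarrow> 'a) \<Rightarrow> 'a set \<Rightarrow> 'a topology \<Rightarrow> bool" where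
  "topological_algebra ar I A \<tau> \<longleftrightarrow>
     universal_algebra ar I A \<and> topspace \<tau> = A \<and>
     (\<forall>f. continuous_map (product_topology (\<lambda>_. \<tau>) {..<ar f}) \<tau> (\<lambda>x. I f (map x [0..<ar f])))"

definition T2_separated :: "'a topology \<Rightarrow> 'a \<Rightarrow> 'a \<Rightarrow> bool" where
  "T2_separated X c d \<longleftrightarrow>
     (\<exists>U V. openin X U \<and> openin X V \<and> c \<in> U \<and> d \<in> V \<and> disjnt U V)"

definition T2half_separated :: "'a topology \<Rightarrow> 'a \<Rightarrow> 'a \<Rightarrow> bool" where
  "T2half_separated X c d \<longleftrightarrow>
     (\<exists>U V. openin X U \<and> openin X V \<and> c \<in> U \<and> d \<in> V \<and>
            disjnt (X closure_of U) (X closure_of V))"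

end

theory Submission
  imports Defs
begin

text \<open>
  Write \<open>x \<le> y\<close> if \<open>x\<close> lies in the closure of \<open>{y}\<close>; continuous maps, hence term operations,
  preserve this preorder. If \<open>c \<le> 0\<close>, then
  \<open>0 = s\<^sub>1(c,c) \<le> s\<^sub>1(c,0) = s\<^sub>2(c,c) \<le> \<dots> \<le> s\<^sub>n\<^sub>-\<^sub>1(c,0) = c\<close>, so \<open>c = 0\<close> by \<open>T\<^sub>0\<close>. Hence \<open>{0}\<close> is closed.

  Two points are \<open>T\<^sub>2\<close>-separated if the pair of them has an open neighbourhood missing the diagonal, and
  \<open>T\<^sub>2\<^sub>1\<^sub>/\<^sub>2\<close>-separated if it has one whose closure misses the diagonal. On \<open>Diag\<^sub>i\<close> the continuous map
  \<open>s\<^sub>i\<close> sends the diagonal to \<open>0\<close>, so preimages under \<open>s\<^sub>i\<close> of open sets that miss \<open>0\<close>, or whose closure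
  misses \<open>0\<close>, are such neighbourhoods.
\<close>

lemma T2_separated_iff_disjnt_Id:
  "T2_separated X a b \<longleftrightarrow> (\<exists>N. openin (prod_topology X X) N \<and> (a, b) \<in> N \<and> disjnt N Id)"
proof
  assume "T2_separated X a b"
  then obtain U V where "openin X U" "openin X V" "a \<in> U" "b \<in> V" "disjnt U V"
    unfolding T2_separated_def by blast
  then show "\<exists>N. openin (prod_topology X X) N \<and> (a, b) \<in> N \<and> disjnt N Id"
    by (intro exI[of _ "U \<times> V"]) (auto simp: openin_prod_Times_iff disjnt_iff)
next
  assume "\<exists>N. openin (prod_topology X X) N \<and> (a, b) \<in> N \<and> disjnt N Id"
  then obtain N U V where "disjnt N Id" "U \<times> V \<subseteq> N" "openin X U" "openin X V" "a \<in> U" "b \<in> V"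
    unfolding openin_prod_topology_alt by meson
  moreover from this have "disjnt U V"
    by (auto simp: disjnt_iff)
  ultimately show "T2_separated X a b"
    unfolding T2_separated_def by blast
qed

lemma T2half_separated_iff_disjnt_Id:
  "T2half_separated X a b \<longleftrightarrow>
    (\<exists>N. openin (prod_topology X X) N \<and> (a, b) \<in> N \<and> disjnt (prod_topology X X closure_of N) Id)"
proof
  assume "T2half_separated X a b"
  then obtain U V where "openin X U" "openin X V" "a \<in> U" "b \<in> V"
    "disjnt (X closure_of U) (X closure_of V)"
    unfolding T2half_separated_def by blast
  then show "\<exists>N. openin (prod_topology X X) N \<and> (a, b) \<in> N \<and>
      disjnt (prod_topology X X closure_of N) Id"
    by (intro exI[of _ "U \<times> V"]) (auto simp: openin_prod_Times_iff closure_of_Times disjnt_iff)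
next
  assume "\<exists>N. openin (prod_topology X X) N \<and> (a, b) \<in> N \<and>
    disjnt (prod_topology X X closure_of N) Id"
  then obtain N U V where disj: "disjnt (prod_topology X X closure_of N) Id"
    and sub: "U \<times> V \<subseteq> N" and UV: "openin X U" "openin X V" "a \<in> U" "b \<in> V"
    unfolding openin_prod_topology_alt by meson
  have "(X closure_of U) \<times> (X closure_of V) \<subseteq> prod_topology X X closure_of N"
    using closure_of_mono[OF sub, of "prod_topology X X"] by (simp add: closure_of_Times)
  with disj have "disjnt (X closure_of U) (X closure_of V)"
    by (auto simp: disjnt_iff)
  with UV show "T2half_separated X a b"
    unfolding T2half_separated_def by blast
qed

lemma T2_separated_iff_notin_closure_of:
  assumes "d \<in> topspace X"
  shows "T2_separated X c d \<longleftrightarrow> (\<exists>U. openin X U \<and> c \<in> U \<and> d \<notin> X closure_of U)"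
  using assms unfolding T2_separated_def in_closure_of disjnt_iff by metis

lemma continuous_map_imp_T2_separated:
  assumes f: "continuous_map (prod_topology X X) Y f"
    and diagonal: "\<And>x. x \<in> topspace X \<Longrightarrow> f (x, x) \<in> C"
    and "closedin Y C" and "f (a, b) \<notin> C" and "a \<in> topspace X" and "b \<in> topspace X"
  shows "T2_separated X a b"
proof -
  let ?N = "{p \<in> topspace (prod_topology X X). f p \<in> topspace Y - C}"
  have "openin (prod_topology X X) ?N"
    using f \<open>closedin Y C\<close> by (intro openin_continuous_map_preimage) auto
  moreover have "(a, b) \<in> ?N"
    using assms by (auto simp: continuous_map_def)
  moreover have "disjnt ?N Id"
    using diagonal by (auto simp: disjnt_iff)
  ultimately show ?thesis
    unfolding T2_separated_iff_disjnt_Id by blast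
qed

lemma continuous_map_imp_T2half_separated:
  assumes f: "continuous_map (prod_topology X X) Y f"
    and diagonal: "\<And>x. x \<in> topspace X \<Longrightarrow> f (x, x) = e"
    and "T2_separated Y (f (a, b)) e" and "a \<in> topspace X" and "b \<in> topspace X"
  shows "T2half_separated X a b"
proof -
  have "f (a, a) \<in> topspace Y"
    using f \<open>a \<in> topspace X\<close> by (auto simp: continuous_map_def)
  then have "e \<in> topspace Y"
    using diagonal \<open>a \<in> topspace X\<close> by simp
  then obtain U where U: "openin Y U" "f (a, b) \<in> U" "e \<notin> Y closure_of U"
    using assms(3) by (auto simp: T2_separated_iff_notin_closure_of)
  let ?N = "{p \<in> topspace (prod_topology X X). f p \<in> U}"
  have "openin (prod_topology X X) ?N"
    using f \<open>openin Y U\<close> by (rule openin_continuous_map_preimage)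
  moreover have "(a, b) \<in> ?N"
    using assms(4,5) U(2) by simp
  moreover have "disjnt (prod_topology X X closure_of ?N) Id"
    using continuous_map_closure_preimage_subset[OF f, of U] diagonal U(3)
    by (fastforce simp: disjnt_iff)
  ultimately show ?thesis
    unfolding T2half_separated_iff_disjnt_Id by blast
qed

lemma in_closure_of_singleton_trans:
  assumes "x \<in> X closure_of {y}" and "y \<in> X closure_of {z}"
  shows "x \<in> X closure_of {z}"
  using assms by (simp add: in_closure_of)

lemma t0_space_in_closure_of_antisym:
  assumes "t0_space X" and "x \<in> X closure_of {y}" and "y \<in> X closure_of {x}"
  shows "x = y"
proof -
  have "X closure_of {x} = X closure_of {y}"
    using assms(2,3) by (blast intro: in_closure_of_singleton_trans)
  moreover have "x \<in> topspace X" "y \<in> topspace X"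
    using assms(2,3) by (simp_all add: in_closure_of)
  ultimately show ?thesis
    using assms(1) by (simp add: t0_space_closure_of_sing)
qed

lemma trm_arity_TVar [simp]: "trm_arity ar k (TVar v) \<longleftrightarrow> v < k"
  by (simp add: trm_arity_def)

lemma trm_arity_TOp [simp]:
  "trm_arity ar k (TOp f ts) \<longleftrightarrow> length ts = ar f \<and> (\<forall>t\<in>set ts. trm_arity ar k t)"
  by (auto simp: trm_arity_def list_all_iff)

lemma trm_op_in_carrier:
  assumes "universal_algebra ar I A" and "trm_arity ar (length xs) t" and "set xs \<subseteq> A"
  shows "trm_op I t xs \<in> A"
  using assms(2)
proof (induction t)
  case (TVar v)
  with assms(3) show ?case
    by (simp add: subset_iff)
next
  case (TOp f ts)
  then have "length (map (\<lambda>t. trm_op I t xs) ts) = ar f" "set (map (\<lambda>t. trm_op I t xs) ts) \<subseteq> A"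
    by auto
  with assms(1) show ?case
    unfolding universal_algebra_def by simp
qed

lemma continuous_map_trm_op:
  assumes alg: "topological_algebra ar I A \<tau>"
    and "trm_arity ar (length gs) t"
    and gs: "\<And>g. g \<in> set gs \<Longrightarrow> continuous_map X \<tau> g"
  shows "continuous_map X \<tau> (\<lambda>x. trm_op I t (map (\<lambda>g. g x) gs))"
  using assms(2)
proof (induction t)
  case (TVar v)
  with gs show ?case
    by simp
next
  case (TOp f ts)
  let ?args = "\<lambda>x. \<lambda>j\<in>{..<ar f}. trm_op I (ts ! j) (map (\<lambda>g. g x) gs)"
  have "continuous_map X \<tau> (\<lambda>x. trm_op I (ts ! j) (map (\<lambda>g. g x) gs))" if "j < ar f" for j
    using TOp that by simp
  then have "continuous_map X (product_topology (\<lambda>_. \<tau>) {..<ar f}) ?args"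
    by (auto simp: continuous_map_componentwise)
  moreover have "continuous_map (product_topology (\<lambda>_. \<tau>) {..<ar f}) \<tau>
      (\<lambda>x. I f (map x [0..<ar f]))"
    using alg by (simp add: topological_algebra_def)
  ultimately have "continuous_map X \<tau> (\<lambda>x. I f (map (?args x) [0..<ar f]))"
    by (auto dest: continuous_map_compose simp: o_def)
  moreover have "map (?args x) [0..<ar f] = map (\<lambda>t. trm_op I t (map (\<lambda>g. g x) gs)) ts" for x
    using TOp.prems by (auto intro: nth_equalityI)
  ultimately show ?case
    by simp
qed

lemma continuous_map_binary_trm_op:
  assumes "topological_algebra ar I A \<tau>" and "trm_arity ar 2 t"
    and "continuous_map X \<tau> g" and "continuous_map X \<tau> h"
  shows "continuous_map X \<tau> (\<lambda>x. trm_op I t [g x, h x])"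
proof -
  have "trm_arity ar (length [g, h]) t"
    using assms(2) by (simp add: numeral_2_eq_2)
  from continuous_map_trm_op[OF assms(1) this] show ?thesis
    using assms(3,4) by auto
qed

lemma trm_op_in_closure_of:
  assumes "topological_algebra ar I A \<tau>" and "trm_arity ar 2 t"
    and "x \<in> A" and "y \<in> \<tau> closure_of {y'}"
  shows "trm_op I t [x, y] \<in> \<tau> closure_of {trm_op I t [x, y']}"
proof -
  have "continuous_map \<tau> \<tau> (\<lambda>y. trm_op I t [x, y])"
    using assms(1-3) by (intro continuous_map_binary_trm_op) (auto simp: topological_algebra_def)
  from continuous_map_image_closure_subset[OF this, of "{y'}"] show ?thesis
    using assms(4) by auto
qed

lemma n_subtractive_zero_in_closure_of:
  assumes alg: "topological_algebra ar I A \<tau>" and sub: "n_subtractive ar I A n z s"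
    and below_zero: "c \<in> \<tau> closure_of {trm_op I z []}"
  shows "trm_op I z [] \<in> \<tau> closure_of {c}"
proof -
  let ?zero = "trm_op I z []"
  have carrier: "c \<in> A"
    using alg below_zero by (simp add: in_closure_of topological_algebra_def)
  have replace_by_zero: "trm_op I (s j) [c, c] \<in> \<tau> closure_of {trm_op I (s j) [c, ?zero]}"
    if "j \<in> {1..n - 1}" for j
    using trm_op_in_closure_of[OF alg _ carrier below_zero] sub that
    by (simp add: n_subtractive_def)
  have "?zero \<in> \<tau> closure_of {trm_op I (s j) [c, ?zero]}" if "1 \<le> j" "j \<le> n - 1" for j
    using that
  proof (induction j rule: nat_induct_at_least)
    case base
    then show ?case
      using replace_by_zero[of 1] sub carrier by (simp add: n_subtractive_def)
  next
    case (Suc j)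
    then have "j \<in> {1..n - 2}"
      by simp
    then have "trm_op I (s j) [c, ?zero] = trm_op I (s (Suc j)) [c, c]"
      using sub carrier unfolding n_subtractive_def by simp
    with Suc have "?zero \<in> \<tau> closure_of {trm_op I (s (Suc j)) [c, c]}"
      by simp
    then show ?case
      using replace_by_zero[of "Suc j"] Suc.prems by (auto intro: in_closure_of_singleton_trans)
  qed
  moreover have "1 \<le> n - 1"
    using sub by (auto simp: n_subtractive_def)
  ultimately have "?zero \<in> \<tau> closure_of {trm_op I (s (n - 1)) [c, ?zero]}"
    by blast
  then show ?thesis
    using sub carrier by (simp add: n_subtractive_def)
qed

lemma n_subtractive_t0_closedin_zero:
  assumes alg: "topological_algebra ar I A \<tau>" and "t0_space \<tau>"
    and sub: "n_subtractive ar I A n z s"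
  shows "closedin \<tau> {trm_op I z []}"
proof -
  let ?zero = "trm_op I z []"
  have "?zero \<in> topspace \<tau>"
    using trm_op_in_carrier[of ar I A "[]" z] alg sub
    by (simp add: topological_algebra_def n_subtractive_def)
  then have "?zero \<in> \<tau> closure_of {?zero}"
    by (simp add: in_closure_of)
  moreover have "c = ?zero" if "c \<in> \<tau> closure_of {?zero}" for c
    using \<open>t0_space \<tau>\<close> that n_subtractive_zero_in_closure_of[OF alg sub that]
    by (rule t0_space_in_closure_of_antisym)
  ultimately have "\<tau> closure_of {?zero} = {?zero}"
    by blast
  then show ?thesis
    by (simp add: closure_of_eq)
qed

theorem theorem6p9:
  fixes ar :: "'f \<Rightarrow> nat" and I :: "'f \<Rightarrow> 'a list \<Rightarrow> 'a" and A :: "'a set" and \<tau> :: "'a topology"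
    and n i :: nat and z :: "'f trm" and s :: "nat \<Rightarrow> 'f trm" and a b :: 'a
  assumes "topological_algebra ar I A \<tau>"
    and "t0_space \<tau>"
    and "n_subtractive ar I A n z s"
    and "1 \<le> i" and "i \<le> n - 1"
    and "a \<in> Diag I A z s i" and "b \<in> Diag I A z s i"
  shows "(trm_op I (s i) [a, b] \<noteq> trm_op I z [] \<longrightarrow>
            T2_separated (subtopology \<tau> (Diag I A z s i)) a b) \<and>
         (T2_separated \<tau> (trm_op I (s i) [a, b]) (trm_op I z []) \<longrightarrow>
            T2half_separated (subtopology \<tau> (Diag I A z s i)) a b)"
proof -
  let ?zero = "trm_op I z []" and ?X = "subtopology \<tau> (Diag I A z s i)"
  let ?f = "\<lambda>p. trm_op I (s i) [fst p, snd p]"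
  have "trm_arity ar 2 (s i)"
    using assms(3-5) by (simp add: n_subtractive_def)
  then have f: "continuous_map (prod_topology ?X ?X) \<tau> ?f"
    using continuous_map_fst continuous_map_snd
    by (blast intro: continuous_map_binary_trm_op[OF assms(1)] continuous_map_into_fulltopology)
  have ab: "a \<in> topspace ?X" "b \<in> topspace ?X"
    using assms(1,6,7) by (auto simp: topological_algebra_def Diag_def)
  have diagonal: "?f (x, x) = ?zero" if "x \<in> topspace ?X" for x
    using that by (simp add: Diag_def)
  have zero_closed: "closedin \<tau> {?zero}"
    using assms(1-3) by (rule n_subtractive_t0_closedin_zero)
  have "T2_separated ?X a b" if "trm_op I (s i) [a, b] \<noteq> ?zero"
    using continuous_map_imp_T2_separated[OF f _ zero_closed _ ab] diagonal that by simp
  moreover have "T2half_separated ?X a b" if "T2_separated \<tau> (trm_op I (s i) [a, b]) ?zero"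
    using continuous_map_imp_T2half_separated[OF f diagonal _ ab] that by simp
  ultimately show ?thesis
    by blast
qed

end
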